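(* In the downlink NOMA model of the context with $K$ subcarriers (CD-NOMA), assume $a_m>\varepsilon_m a_n$ and $a_n>\varepsilon_n a_m$. Consider the connection outage probability of the $n$-th user for the alternative formulation (ALF), $P_{n2}(\rho)=\Pr\{\gamma_{n\to m}\le\varepsilon_m,\ \gamma_{n\to n}\le\varepsilon_n\}+\Pr\{\gamma_{n\to m}>\varepsilon_m,\ \gamma_n\le\varepsilon_n\}$. Its diversity order is $0$ with imperfect SIC ($\varpi=1$) and $nK$ with perfect SIC ($\varpi=0$).
   Context: Fix integers $M>K\ge 1$ and $1\le m<n\le M$, reals $\eta,\alpha,R_D,\Omega_I>0$, power coefficients $a_m>a_n>0$ with $a_m+a_n=1$, and target rates $R_m,R_n>0$ with $\varepsilon_m=2^{R_m}-1$, $\varepsilon_n=2^{R_n}-1$; $\rho>0$ is the transmit SNR. ($K\neq1$ is called CD-NOMA, $K=1$ PD-NOMA.) $M$ users are placed independently and uniformly in a disc of radius $R_D$ centred at the base station. A user at distance $d$ from the centre has channel vector in $\mathbb{C}^K$ with entries $\sqrt{\eta}\,h_k/\sqrt{1+d^\alpha}$, $k=1,\dots,K$, where the $h_k$ are i.i.d. $\mathcal{CN}(0,1)$ (circularly symmetric, $\mathbb{E}|h_k|^2=1$), independent across users and of the locations. Users are relabelled so that their channel vectors satisfy $\|\mathbf h_1\|_2^2<\dots<\|\mathbf h_M\|_2^2$. The signals of users $m$ and $n$ are spread over the $K$ subcarriers by indicator vectors $\mathbf g_m,\mathbf g_n\in\{0,1\}^K$ of the same weight, all $K$ subcarriers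 being occupied, so $\|\mathrm{diag}(\mathbf h_n)\mathbf g_m\|_2^2=\|\mathrm{diag}(\mathbf h_n)\mathbf g_n\|_2^2=\|\mathbf h_n\|_2^2=:Z_n$. The residual interference vector $\mathbf h_I$ has $K$ i.i.d. $\mathcal{CN}(0,\Omega_I)$ entries, independent of everything else, and $Y_I=\|\mathbf h_I\|_2^2$. SINRs: $\gamma_{n\to m}=\frac{\rho Z_n a_m}{\rho Z_n a_n+1}$, $\gamma_n=\frac{\rho Z_n a_n}{\varpi\rho Y_I+1}$, $\gamma_{n\to n}=\frac{\rho Z_n a_n}{\rho Z_n a_m+1}$. Diversity order of an outage probability $P(\rho)$: $d=-\lim_{\rho\to\infty}\frac{\log P^\infty(\rho)}{\log\rho}$, where $P^\infty$ is the asymptotic outage probability at high SNR, i.e. $P(\rho)/P^\infty(\rho)\to1$ as $\rho\to\infty$. *)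

theory Defs
  imports "HOL-Probability.Probability"
begin

text \<open>The number \<open>K\<close> of subcarriers is \<open>CARD('k)\<close>, so channel vectors have type
  \<open>complex ^ 'k\<close> and their 2-norm is the library norm. The plane containing the cell is
  identified with \<open>complex\<close>, so that locations and fading coefficients have the same type and
  their mutual independence can be expressed by a single \<open>indep_vars\<close> family, indexed as
  follows.\<close>

datatype 'k rv = Location nat | Fading nat 'k | Residual 'k

definition cn_density :: "real \<Rightarrow> complex \<Rightarrow> real" where
  "cn_density v z = exp (- (cmod z)\<^sup>2 / v) / (pi * v)"

text \<open>The variables refer to the users before relabelling; only the users \<open>1, ..., M\<close> are
  constrained.\<close>

locale noma_model = prob_space S
  for S :: "'a measure" +
  fixes M :: nat
    and R\<^sub>D \<Omega>\<^sub>I :: real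
    and loc :: "nat \<Rightarrow> 'a \<Rightarrow> complex"
    and h :: "nat \<Rightarrow> 'k::finite \<Rightarrow> 'a \<Rightarrow> complex"
    and h\<^sub>I :: "'k \<Rightarrow> 'a \<Rightarrow> complex"
  assumes location_uniform:
      "\<And>i. i \<in> {1..M} \<Longrightarrow> distr S lborel (loc i) = uniform_measure lborel (cball 0 R\<^sub>D)"
    and fading_CN:
      "\<And>i k. i \<in> {1..M} \<Longrightarrow> distributed S lborel (h i k) (\<lambda>z. ennreal (cn_density 1 z))"
    and residual_CN:
      "\<And>k. distributed S lborel (h\<^sub>I k) (\<lambda>z. ennreal (cn_density \<Omega>\<^sub>I z))"
    and independent:
      "indep_vars (\<lambda>_. borel)
         (\<lambda>j. case j of Location i \<Rightarrow> loc i | Fading i k \<Rightarrow> h i k | Residual k \<Rightarrow> h\<^sub>I k)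
         (Location ` {1..M} \<union> (\<Union>i\<in>{1..M}. range (Fading i)) \<union> range Residual)"

definition channel ::
  "real \<Rightarrow> real \<Rightarrow> (nat \<Rightarrow> 'a \<Rightarrow> complex) \<Rightarrow> (nat \<Rightarrow> 'k::finite \<Rightarrow> 'a \<Rightarrow> complex)
     \<Rightarrow> nat \<Rightarrow> 'a \<Rightarrow> complex ^ 'k" where
  "channel \<eta> \<alpha> loc h i \<omega> =
     (\<chi> k. of_real (sqrt \<eta>) * h i k \<omega> / of_real (sqrt (1 + dist (loc i \<omega>) 0 powr \<alpha>)))"

text \<open>The original index of the user that receives label \<open>n\<close> when the \<open>M\<close> users are relabelled
  by increasing channel gain. Ties, which have probability zero, go to the smaller original
  index.\<close>

definition ranked_user :: "nat \<Rightarrow> (nat \<Rightarrow> 'a \<Rightarrow> complex ^ 'k::finite) \<Rightarrow> nat \<Rightarrow> 'a \<Rightarrow> nat" where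
  "ranked_user M H n \<omega> = sort_key (\<lambda>i. (norm (H i \<omega>))\<^sup>2) [1..<Suc M] ! (n - 1)"

definition ordered_channel ::
  "nat \<Rightarrow> (nat \<Rightarrow> 'a \<Rightarrow> complex ^ 'k::finite) \<Rightarrow> nat \<Rightarrow> 'a \<Rightarrow> complex ^ 'k" where
  "ordered_channel M H n \<omega> = H (ranked_user M H n \<omega>) \<omega>"

definition ordered_gain :: "nat \<Rightarrow> (nat \<Rightarrow> 'a \<Rightarrow> complex ^ 'k::finite) \<Rightarrow> nat \<Rightarrow> 'a \<Rightarrow> real" where
  "ordered_gain M H n \<omega> = (norm (ordered_channel M H n \<omega>))\<^sup>2"

definition residual_gain :: "('k::finite \<Rightarrow> 'a \<Rightarrow> complex) \<Rightarrow> 'a \<Rightarrow> real" where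
  "residual_gain h\<^sub>I \<omega> = (norm (\<chi> k. h\<^sub>I k \<omega>))\<^sup>2"

definition target_sinr :: "real \<Rightarrow> real" where
  "target_sinr R = 2 powr R - 1"

text \<open>The SINRs at user \<open>n\<close>, with \<open>z\<close> and \<open>y\<close> the values of the channel gain and of the residual
  interference gain; \<open>\<kappa>\<close> is \<open>1\<close> for imperfect and \<open>0\<close> for perfect SIC.\<close>

definition \<gamma>_n_to_m :: "real \<Rightarrow> real \<Rightarrow> real \<Rightarrow> real \<Rightarrow> real" where
  "\<gamma>_n_to_m a\<^sub>m a\<^sub>n \<rho> z = \<rho> * z * a\<^sub>m / (\<rho> * z * a\<^sub>n + 1)"

definition \<gamma>_n :: "real \<Rightarrow> real \<Rightarrow> real \<Rightarrow> real \<Rightarrow> real \<Rightarrow> real" where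
  "\<gamma>_n a\<^sub>n \<kappa> \<rho> z y = \<rho> * z * a\<^sub>n / (\<kappa> * \<rho> * y + 1)"

definition \<gamma>_n_to_n :: "real \<Rightarrow> real \<Rightarrow> real \<Rightarrow> real \<Rightarrow> real" where
  "\<gamma>_n_to_n a\<^sub>m a\<^sub>n \<rho> z = \<rho> * z * a\<^sub>n / (\<rho> * z * a\<^sub>m + 1)"

definition outage_ALF ::
  "'a measure \<Rightarrow> ('a \<Rightarrow> real) \<Rightarrow> ('a \<Rightarrow> real) \<Rightarrow> real \<Rightarrow> real \<Rightarrow> real \<Rightarrow> real \<Rightarrow> real \<Rightarrow> real \<Rightarrow> real" where
  "outage_ALF S Z Y a\<^sub>m a\<^sub>n R\<^sub>m R\<^sub>n \<kappa> \<rho> =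
     \<P>(\<omega> in S. \<gamma>_n_to_m a\<^sub>m a\<^sub>n \<rho> (Z \<omega>) \<le> target_sinr R\<^sub>m \<and>
               \<gamma>_n_to_n a\<^sub>m a\<^sub>n \<rho> (Z \<omega>) \<le> target_sinr R\<^sub>n) +
     \<P>(\<omega> in S. \<gamma>_n_to_m a\<^sub>m a\<^sub>n \<rho> (Z \<omega>) > target_sinr R\<^sub>m \<and>
               \<gamma>_n a\<^sub>n \<kappa> \<rho> (Z \<omega>) (Y \<omega>) \<le> target_sinr R\<^sub>n)"

definition high_SNR_asymptote :: "(real \<Rightarrow> real) \<Rightarrow> (real \<Rightarrow> real) \<Rightarrow> bool" where
  "high_SNR_asymptote P Q \<longleftrightarrow> ((\<lambda>\<rho>. P \<rho> / Q \<rho>) \<longlongrightarrow> 1) at_top"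

text \<open>An asymptote is not unique as a function. The definition asks that one exists, which excludes
  outage probabilities that vanish for arbitrarily large SNR, and that every choice gives the
  same limit.\<close>

definition has_diversity_order :: "(real \<Rightarrow> real) \<Rightarrow> real \<Rightarrow> bool" where
  "has_diversity_order P d \<longleftrightarrow>
     (\<exists>Q. high_SNR_asymptote P Q) \<and>
     (\<forall>Q. high_SNR_asymptote P Q \<longrightarrow>
        ((\<lambda>\<rho>. - (ln (Q \<rho>) / ln \<rho>)) \<longlongrightarrow> d) at_top)"

end

(* The gain Z of the n-th weakest user has a distribution function of exact order x^(nK) at 0.
   If all fading coefficients of users 1, ..., n are at most of order sqrt x, then Z <= x.
   Conversely Z <= x means that some n users have gain at most x, and as the path loss is bounded
   on the disc, all nK of their fading coefficients are of order sqrt x. A CN variable lies in a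
   ball of radius r with probability of order r^2, so independence gives both bounds.
   With perfect SIC the outage event is squeezed between events Z <= c / rho, and two-sided bounds
   up to constants suffice, since ln P / ln rho forgets constants. With imperfect SIC the event
   Z <= theta, Y >= 1 has a positive probability independent of rho, and the part of it with
   Z <= tau / rho is negligible, so P stays bounded away from 0. *)

theory Submission
  imports Defs
begin

section \<open>Order statistics of a finite family\<close>

text \<open>Sorting turns a sublevel set of \<open>f\<close> into an initial segment of the list,
  and position \<open>k\<close>, counted from 0, lies in that segment exactly when it has more than
  \<open>k\<close> entries. Distinctness makes lengths of segments equal to cardinalities.\<close>

lemma nth_sort_key_le_iff:
  fixes f :: "'b \<Rightarrow> 'c::linorder"
  assumes "distinct xs" "k < length xs"
  shows "f (sort_key f xs ! k) \<le> x \<longleftrightarrow> k < card {i \<in> set xs. f i \<le> x}"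
proof -
  define ys where "ys = sort_key f xs"
  have ys: "distinct ys" "set ys = set xs" "length ys = length xs" "sorted (map f ys)"
    using assms by (auto simp: ys_def)
  have mono: "f (ys ! i) \<le> f (ys ! j)" if "i \<le> j" "j < length ys" for i j
    using sorted_nth_mono[OF ys(4), of i j] that by simp
  show ?thesis
  proof
    assume le: "f (sort_key f xs ! k) \<le> x"
    have "set (take (Suc k) ys) \<subseteq> {i \<in> set xs. f i \<le> x}"
    proof
      fix y assume "y \<in> set (take (Suc k) ys)"
      then obtain i where "i \<le> k" "y = ys ! i"
        using assms ys(3) by (auto simp: in_set_conv_nth less_Suc_eq_le)
      then show "y \<in> {i \<in> set xs. f i \<le> x}"
        using mono[of i k] le assms ys order_trans[of "f (ys ! i)" "f (ys ! k)" x]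
        by (simp add: ys_def[symmetric]) (metis nth_mem order_le_less_trans)
    qed
    then have "card (set (take (Suc k) ys)) \<le> card {i \<in> set xs. f i \<le> x}"
      by (intro card_mono) auto
    then show "k < card {i \<in> set xs. f i \<le> x}"
      using assms ys by (simp add: distinct_card)
  next
    assume less: "k < card {i \<in> set xs. f i \<le> x}"
    show "f (sort_key f xs ! k) \<le> x"
    proof (rule ccontr)
      assume "\<not> f (sort_key f xs ! k) \<le> x"
      then have gt: "x < f (ys ! k)" by (simp add: ys_def)
      \<comment> \<open>By monotonicity all entries from position \<open>k\<close> on have a key
        above \<open>x\<close>, so the sublevel set fits into the first \<open>k\<close>
        positions.\<close>
      have "{i \<in> set xs. f i \<le> x} \<subseteq> set (take k ys)"
      proof
        fix y assume y: "y \<in> {i \<in> set xs. f i \<le> x}"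
        then obtain i where i: "i < length ys" "y = ys ! i"
          using ys(2) by (metis (mono_tags, lifting) in_set_conv_nth mem_Collect_eq)
        have "i < k"
        proof (rule ccontr)
          assume "\<not> i < k"
          then show False using mono[of k i] i y gt by auto
        qed
        then show "y \<in> set (take k ys)"
          using i by (auto simp: in_set_conv_nth)
      qed
      then have "card {i \<in> set xs. f i \<le> x} \<le> card (set (take k ys))"
        by (intro card_mono) auto
      also have "\<dots> \<le> k"
        using card_length[of "take k ys"] by simp
      finally show False using less by simp
    qed
  qed
qed

lemma ordered_gain_le_iff:
  assumes "n \<in> {1..M}"
  shows "ordered_gain M H n \<omega> \<le> x \<longleftrightarrow> n \<le> card {i \<in> {1..M}. (norm (H i \<omega>))\<^sup>2 \<le> x}"
proof -
  have "{i \<in> set [1..<Suc M]. (norm (H i \<omega>))\<^sup>2 \<le> x} = {i \<in> {1..M}. (norm (H i \<omega>))\<^sup>2 \<le> x}"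
    by auto
  \<comment> \<open>Labels start at 1 and list positions at 0; the truncated subtraction is harmless
    because \<open>n\<close> is at least 1.\<close>
  moreover have "(n - 1 < c) = (n \<le> c)" for c
    using assms by auto
  ultimately show ?thesis
    using nth_sort_key_le_iff[of "[1..<Suc M]" "n - 1" "\<lambda>i. (norm (H i \<omega>))\<^sup>2" x] assms
    unfolding ordered_gain_def ordered_channel_def ranked_user_def by (simp del: upt_Suc)
qed

text \<open>This form replaces the random relabelling by a finite union, over sets of
  \<open>n\<close> original users, of events to which independence and the union bound
  apply.\<close>

lemma ordered_gain_le_iff_ex:
  assumes "n \<in> {1..M}"
  shows "ordered_gain M H n \<omega> \<le> x \<longleftrightarrow>
    (\<exists>A\<subseteq>{1..M}. card A = n \<and> (\<forall>i\<in>A. (norm (H i \<omega>))\<^sup>2 \<le> x))"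
  unfolding ordered_gain_le_iff[OF assms]
proof
  assume "n \<le> card {i \<in> {1..M}. (norm (H i \<omega>))\<^sup>2 \<le> x}"
  then obtain A where "A \<subseteq> {i \<in> {1..M}. (norm (H i \<omega>))\<^sup>2 \<le> x}" "card A = n"
    by (meson obtain_subset_with_card_n)
  then show "\<exists>A\<subseteq>{1..M}. card A = n \<and> (\<forall>i\<in>A. (norm (H i \<omega>))\<^sup>2 \<le> x)"
    by (intro exI[of _ A]) auto
next
  assume "\<exists>A\<subseteq>{1..M}. card A = n \<and> (\<forall>i\<in>A. (norm (H i \<omega>))\<^sup>2 \<le> x)"
  then obtain A where "A \<subseteq> {1..M}" "card A = n" "\<forall>i\<in>A. (norm (H i \<omega>))\<^sup>2 \<le> x"
    by blast
  then have "A \<subseteq> {i \<in> {1..M}. (norm (H i \<omega>))\<^sup>2 \<le> x}" "card A = n"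
    by auto
  then show "n \<le> card {i \<in> {1..M}. (norm (H i \<omega>))\<^sup>2 \<le> x}"
    using card_mono[of "{i \<in> {1..M}. (norm (H i \<omega>))\<^sup>2 \<le> x}" A] by simp
qed

section \<open>Channel gain in terms of fading and path loss\<close>

lemma norm_vec_sq: "(norm (x :: complex ^ 'k::finite))\<^sup>2 = (\<Sum>k\<in>UNIV. (cmod (x $ k))\<^sup>2)"
  by (simp add: norm_vec_def L2_set_def sum_nonneg)

lemma norm_channel_sq:
  assumes "\<eta> > 0"
  shows "(norm (channel \<eta> \<alpha> loc h i \<omega>))\<^sup>2 =
    \<eta> * (\<Sum>k\<in>UNIV. (cmod (h i k \<omega>))\<^sup>2) / (1 + cmod (loc i \<omega>) powr \<alpha>)"
proof -
  have "(cmod (channel \<eta> \<alpha> loc h i \<omega> $ k))\<^sup>2 =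
      \<eta> * (cmod (h i k \<omega>))\<^sup>2 / (1 + cmod (loc i \<omega>) powr \<alpha>)" for k
    using assms
    by (simp add: channel_def norm_mult norm_divide power_mult_distrib power_divide abs_of_nonneg)
  then show ?thesis
    by (simp add: norm_vec_sq sum_distrib_left sum_divide_distrib)
qed

section \<open>Complex Gaussian probabilities of discs\<close>

lemma emeasure_lborel_cball_complex:
  "r \<ge> 0 \<Longrightarrow> emeasure lborel (cball (c :: complex) r) = ennreal (pi * r\<^sup>2)"
  by (simp add: emeasure_cball unit_ball_vol_2)

text \<open>The density never exceeds its value \<open>1 / (pi * v)\<close> at the origin, and the
  disc has area \<open>pi * r\<^sup>2\<close>.\<close>

lemma (in prob_space) CN_prob_cball_le:
  assumes X: "distributed M lborel X (\<lambda>z. ennreal (cn_density v z))" and "v > 0" "r \<ge> 0"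
  shows "prob (X -` cball c r \<inter> space M) \<le> r\<^sup>2 / v"
proof -
  have "emeasure M (X -` cball c r \<inter> space M) =
      (\<integral>\<^sup>+z. ennreal (cn_density v z) * indicator (cball c r) z \<partial>lborel)"
    by (rule distributed_emeasure[OF X]) simp
  also have "\<dots> \<le> (\<integral>\<^sup>+z. ennreal (1 / (pi * v)) * indicator (cball c r) z \<partial>lborel)"
    using \<open>v > 0\<close>
    by (intro nn_integral_mono mult_right_mono ennreal_leI)
       (auto simp: cn_density_def divide_simps)
  also have "\<dots> = ennreal (1 / (pi * v)) * ennreal (pi * r\<^sup>2)"
    using \<open>r \<ge> 0\<close> by (simp add: nn_integral_cmult_indicator emeasure_lborel_cball_complex)
  also have "\<dots> = ennreal (r\<^sup>2 / v)"
    using \<open>v > 0\<close> by (subst ennreal_mult[symmetric]) auto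
  finally show ?thesis
    using \<open>v > 0\<close> by (simp add: emeasure_eq_measure)
qed

text \<open>Points of the disc have modulus at most \<open>cmod c + r\<close>, and the density
  decreases with the modulus. Centre 0 serves the fading coefficients; a centre away from 0 serves
  to keep the residual interference large.\<close>

lemma (in prob_space) CN_prob_cball_ge:
  assumes X: "distributed M lborel X (\<lambda>z. ennreal (cn_density v z))" and "v > 0" "r \<ge> 0"
  shows "exp (- (cmod c + r)\<^sup>2 / v) * r\<^sup>2 / v \<le> prob (X -` cball c r \<inter> space M)"
proof -
  define b where "b = exp (- (cmod c + r)\<^sup>2 / v) / (pi * v)"
  have b: "b \<ge> 0" using \<open>v > 0\<close> by (simp add: b_def)
  have le: "b \<le> cn_density v z" if "z \<in> cball c r" for z
  proof -
    have "cmod z \<le> cmod c + r"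
      using that norm_triangle_sub[of z c] by (simp add: dist_norm norm_minus_commute)
    then have "(cmod z)\<^sup>2 \<le> (cmod c + r)\<^sup>2"
      by (intro power_mono) auto
    then show ?thesis
      using \<open>v > 0\<close> by (auto simp: cn_density_def b_def intro!: divide_right_mono)
  qed
  have "ennreal (exp (- (cmod c + r)\<^sup>2 / v) * r\<^sup>2 / v) = ennreal b * ennreal (pi * r\<^sup>2)"
    using \<open>v > 0\<close> b by (subst ennreal_mult[symmetric]) (auto simp: b_def)
  also have "\<dots> = (\<integral>\<^sup>+z. ennreal b * indicator (cball c r) z \<partial>lborel)"
    using \<open>r \<ge> 0\<close> by (simp add: nn_integral_cmult_indicator emeasure_lborel_cball_complex)
  also have "\<dots> \<le> (\<integral>\<^sup>+z. ennreal (cn_density v z) * indicator (cball c r) z \<partial>lborel)"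
    using le by (intro nn_integral_mono) (auto simp: indicator_def intro: ennreal_leI)
  also have "\<dots> = emeasure M (X -` cball c r \<inter> space M)"
    by (rule distributed_emeasure[OF X, symmetric]) simp
  finally show ?thesis
    by (simp add: emeasure_eq_measure)
qed

section \<open>Diversity order from two-sided power bounds\<close>

text \<open>After taking logarithms, the constants contribute only terms of the form constant over
  \<open>ln \<rho>\<close>, which vanish in the limit. Replacing \<open>P\<close> by another
  asymptote costs at most a factor 2, which is absorbed in the same way.\<close>

lemma has_diversity_orderI:
  assumes "0 < c"
    and lower: "eventually (\<lambda>\<rho>. c * \<rho> powr (- d) \<le> P \<rho>) at_top"
    and upper: "eventually (\<lambda>\<rho>. P \<rho> \<le> C * \<rho> powr (- d)) at_top"
  shows "has_diversity_order P d"
proof -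
  have pos: "eventually (\<lambda>\<rho>. 0 < P \<rho>) at_top"
    using lower eventually_gt_at_top[of 0]
  proof eventually_elim
    case (elim \<rho>)
    then have "0 < c * \<rho> powr (- d)" using \<open>0 < c\<close> by simp
    then show ?case using elim by linarith
  qed
  \<comment> \<open>The sign of \<open>C\<close> is forced, since the upper bound dominates an
    eventually positive function.\<close>
  have "0 < C"
  proof -
    have "eventually (\<lambda>\<rho>. 0 < C * \<rho> powr (- d)) at_top"
      using upper pos by eventually_elim linarith
    then obtain \<rho> where "0 < C * \<rho> powr (- d)"
      using eventually_happens'[OF trivial_limit_at_top_linorder] by blast
    then show ?thesis by (simp add: zero_less_mult_iff)
  qed
  show ?thesis
    unfolding has_diversity_order_def
  proof (intro conjI allI impI exI)
    \<comment> \<open>\<open>P\<close> is its own asymptote, because the quotient is exactly 1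
      wherever \<open>P\<close> is positive.\<close>
    show "high_SNR_asymptote P P"
      unfolding high_SNR_asymptote_def
      by (rule tendsto_eventually, use pos in eventually_elim) auto
  next
    fix Q assume "high_SNR_asymptote P Q"
    then have PQ: "((\<lambda>\<rho>. P \<rho> / Q \<rho>) \<longlongrightarrow> 1) at_top"
      by (simp add: high_SNR_asymptote_def)
    \<comment> \<open>Besides comparing sizes, the positive lower bound makes \<open>Q\<close>
      positive, so that \<open>ln (Q \<rho>)\<close> is meaningful.\<close>
    have bounds: "eventually (\<lambda>\<rho>. 1 / 2 < P \<rho> / Q \<rho> \<and> P \<rho> / Q \<rho> < 2) at_top"
      by (intro eventually_conj order_tendstoD[OF PQ]) auto
    have two_sided: "eventually (\<lambda>\<rho>. 1 < \<rho> \<and> ln (c / 2) - d * ln \<rho> \<le> ln (Q \<rho>) \<and>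
        ln (Q \<rho>) \<le> ln (2 * C) - d * ln \<rho>) at_top"
      using bounds pos lower upper eventually_gt_at_top[of 1]
    proof eventually_elim
      case (elim \<rho>)
      have Q: "0 < Q \<rho>"
      proof (rule ccontr)
        assume "\<not> 0 < Q \<rho>"
        then have "P \<rho> / Q \<rho> \<le> 0" using elim by (simp add: divide_le_0_iff)
        then show False using elim by linarith
      qed
      have "P \<rho> < 2 * Q \<rho>" "Q \<rho> < 2 * P \<rho>"
        using elim Q by (simp_all add: pos_divide_less_eq pos_less_divide_eq)
      then have "c / 2 * \<rho> powr (- d) \<le> Q \<rho>" "Q \<rho> \<le> 2 * C * \<rho> powr (- d)"
        using elim by linarith+
      then have "ln (c / 2 * \<rho> powr (- d)) \<le> ln (Q \<rho>)" "ln (Q \<rho>) \<le> ln (2 * C * \<rho> powr (- d))"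
        using Q elim \<open>0 < c\<close> \<open>0 < C\<close> by (auto intro!: ln_mono mult_pos_pos)
      then show ?case
        using elim \<open>0 < c\<close> \<open>0 < C\<close> by (simp add: ln_mult ln_powr ln_div)
    qed
    have lim: "((\<lambda>\<rho>::real. d - a / ln \<rho>) \<longlongrightarrow> d) at_top" for a :: real
    proof -
      have "((\<lambda>\<rho>::real. a / ln \<rho>) \<longlongrightarrow> 0) at_top"
        by (rule tendsto_divide_0[OF tendsto_const])
          (rule filterlim_at_top_imp_at_infinity[OF ln_at_top])
      then show ?thesis using tendsto_diff[OF tendsto_const, of _ 0 at_top d] by simp
    qed
    show "((\<lambda>\<rho>. - (ln (Q \<rho>) / ln \<rho>)) \<longlongrightarrow> d) at_top"
    proof (rule tendsto_sandwich[OF _ _ lim[of "ln (2 * C)"] lim[of "ln (c / 2)"]])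
      show "eventually (\<lambda>\<rho>. d - ln (2 * C) / ln \<rho> \<le> - (ln (Q \<rho>) / ln \<rho>)) at_top"
        using two_sided
      proof eventually_elim
        case (elim \<rho>)
        then show ?case
          using divide_right_mono[of "ln (Q \<rho>)" "ln (2 * C) - d * ln \<rho>" "ln \<rho>"]
          by (simp add: diff_divide_distrib)
      qed
      show "eventually (\<lambda>\<rho>. - (ln (Q \<rho>) / ln \<rho>) \<le> d - ln (c / 2) / ln \<rho>) at_top"
        using two_sided
      proof eventually_elim
        case (elim \<rho>)
        then show ?case
          using divide_right_mono[of "ln (c / 2) - d * ln \<rho>" "ln (Q \<rho>)" "ln \<rho>"]
          by (simp add: diff_divide_distrib)
      qed
    qed
  qed
qed

section \<open>SINR conditions as thresholds on the gain\<close>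

text \<open>Clearing the denominator leaves \<open>z\<close> with the factor
  \<open>\<rho> * (a - \<epsilon> * b)\<close>, whose positivity permits the division. The value
  \<open>b = 0\<close> covers the interference-free SINR of perfect SIC.\<close>

lemma sinr_le_iff:
  fixes a b \<epsilon> \<rho> z :: real
  assumes "\<epsilon> * b < a" "0 \<le> b" "0 < \<rho>" "0 \<le> z"
  shows "\<rho> * z * a / (\<rho> * z * b + 1) \<le> \<epsilon> \<longleftrightarrow> z \<le> \<epsilon> / (a - \<epsilon> * b) / \<rho>"
proof -
  have "0 < \<rho> * z * b + 1" using assms by (intro add_nonneg_pos) auto
  then have "\<rho> * z * a / (\<rho> * z * b + 1) \<le> \<epsilon> \<longleftrightarrow> z * (\<rho> * (a - \<epsilon> * b)) \<le> \<epsilon>"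
    by (simp add: pos_divide_le_eq algebra_simps)
  also have "\<dots> \<longleftrightarrow> z \<le> \<epsilon> / (\<rho> * (a - \<epsilon> * b))"
    using assms by (subst pos_le_divide_eq) auto
  finally show ?thesis by (simp add: mult.commute)
qed

section \<open>Measurability and product formulas in the model\<close>

context noma_model
begin

lemma random_variable_fading: "i \<in> {1..M} \<Longrightarrow> random_variable borel (h i k)"
  using distributed_measurable[OF fading_CN] by simp

lemma random_variable_residual: "random_variable borel (h\<^sub>I k)"
  using distributed_measurable[OF residual_CN] by simp

lemma random_variable_location: "i \<in> {1..M} \<Longrightarrow> random_variable borel (loc i)"
  \<comment> \<open>Measurability of the locations is part of \<open>indep_vars\<close>;
    \<open>location_uniform\<close> describes only the image measure.\<close>
  using independent unfolding indep_vars_def by (auto dest!: bspec[of _ _ "Location i"])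

lemma AE_location_le:
  assumes "i \<in> {1..M}"
  shows "AE \<omega> in S. cmod (loc i \<omega>) \<le> R\<^sub>D"
proof (rule AE_distrD[of "loc i" S lborel "\<lambda>z. cmod z \<le> R\<^sub>D"])
  show "loc i \<in> measurable S lborel"
    using random_variable_location[OF assms] by simp
  show "AE z in distr S lborel (loc i). cmod z \<le> R\<^sub>D"
    unfolding location_uniform[OF assms] by (rule AE_uniform_measureI) auto
qed

text \<open>Fading and residual coefficients belong to one independent family, so the joint event
  factorises over single coefficients. Both kinds are treated together because imperfect SIC needs a
  small gain and a large interference at once.\<close>

lemma prob_fading_residual:
  assumes A: "A \<subseteq> {1..M}" and [measurable]: "B \<in> sets borel" "C \<in> sets borel"
  shows "prob {\<omega> \<in> space S. (\<forall>i\<in>A. \<forall>k. h i k \<omega> \<in> B) \<and> (\<forall>k. h\<^sub>I k \<omega> \<in> C)} =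
    (\<Prod>i\<in>A. \<Prod>k\<in>UNIV. prob (h i k -` B \<inter> space S)) *
    (\<Prod>k\<in>UNIV. prob (h\<^sub>I k -` C \<inter> space S))"
proof -
  define X where "X = (\<lambda>j. case j of Location i \<Rightarrow> loc i | Fading i k \<Rightarrow> h i k | Residual k \<Rightarrow> h\<^sub>I k)"
  define E where "E = (\<lambda>j :: 'k rv. case j of Location i \<Rightarrow> UNIV | Fading i k \<Rightarrow> B | Residual k \<Rightarrow> C)"
  define F :: "'k rv set" where "F = (\<lambda>(i, k). Fading i k) ` (A \<times> UNIV)"
  \<comment> \<open>The residual indices keep \<open>J\<close> nonempty even for empty
    \<open>A\<close>, so the intersection over \<open>J\<close> stays inside
    \<open>space S\<close>.\<close>
  define J where "J = F \<union> range Residual"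
  have fin: "finite A" using A finite_subset by blast
  have "J \<subseteq> Location ` {1..M} \<union> (\<Union>i\<in>{1..M}. range (Fading i)) \<union> range Residual"
    using A by (auto simp: J_def F_def)
  then have "indep_vars (\<lambda>_. borel) X J"
    unfolding X_def by (rule indep_vars_subset[OF independent])
  then have "prob (\<Inter>j\<in>J. X j -` E j \<inter> space S) = (\<Prod>j\<in>J. prob (X j -` E j \<inter> space S))"
    by (rule indep_varsD_finite)
       (use fin assms in \<open>auto simp: J_def F_def E_def split: rv.split\<close>)
  also have "(\<Inter>j\<in>J. X j -` E j \<inter> space S) =
      {\<omega> \<in> space S. (\<forall>i\<in>A. \<forall>k. h i k \<omega> \<in> B) \<and> (\<forall>k. h\<^sub>I k \<omega> \<in> C)}"
    by (auto simp: J_def F_def X_def E_def ball_Un)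
  also have "(\<Prod>j\<in>J. prob (X j -` E j \<inter> space S)) =
      (\<Prod>j\<in>F. prob (X j -` E j \<inter> space S)) * (\<Prod>j\<in>range Residual. prob (X j -` E j \<inter> space S))"
    unfolding J_def using fin by (intro prod.union_disjoint) (auto simp: F_def)
  also have "(\<Prod>j\<in>F. prob (X j -` E j \<inter> space S)) =
      (\<Prod>(i, k)\<in>A \<times> UNIV. prob (h i k -` B \<inter> space S))"
    unfolding F_def by (subst prod.reindex) (auto simp: inj_on_def X_def E_def intro!: prod.cong)
  also have "\<dots> = (\<Prod>i\<in>A. \<Prod>k\<in>UNIV. prob (h i k -` B \<inter> space S))"
    by (rule prod.cartesian_product[symmetric])
  also have "(\<Prod>j\<in>range Residual. prob (X j -` E j \<inter> space S)) =
      (\<Prod>k\<in>UNIV. prob (h\<^sub>I k -` C \<inter> space S))"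
    by (subst prod.reindex) (auto simp: inj_on_def X_def E_def)
  finally show ?thesis .
qed

lemma prob_fading:
  assumes "A \<subseteq> {1..M}" "B \<in> sets borel"
  shows "prob {\<omega> \<in> space S. \<forall>i\<in>A. \<forall>k. h i k \<omega> \<in> B} =
    (\<Prod>i\<in>A. \<Prod>k\<in>UNIV. prob (h i k -` B \<inter> space S))"
  using prob_fading_residual[of A B UNIV] assms by (simp add: prob_space)

lemma random_variable_ordered_gain:
  assumes "n \<in> {1..M}" "\<eta> > 0"
  shows "random_variable borel (ordered_gain M (channel \<eta> \<alpha> loc h) n)"
proof (rule borel_measurable_iff_le[THEN iffD2], intro allI)
  fix x
  let ?\<A> = "{A. A \<subseteq> {1..M} \<and> card A = n}"
  have "{\<omega> \<in> space S. (norm (channel \<eta> \<alpha> loc h i \<omega>))\<^sup>2 \<le> x} \<in> events" if "i \<in> {1..M}" for i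
  proof -
    note [measurable] = random_variable_location[OF that] random_variable_fading[OF that]
    show ?thesis unfolding norm_channel_sq[OF \<open>\<eta> > 0\<close>] by measurable
  qed
  then have "(\<Union>A\<in>?\<A>. {\<omega> \<in> space S. \<forall>i\<in>A. (norm (channel \<eta> \<alpha> loc h i \<omega>))\<^sup>2 \<le> x}) \<in> events"
    by (intro sets.finite_UN sets.sets_Collect_finite_All) (auto dest: finite_subset)
  also have "(\<Union>A\<in>?\<A>. {\<omega> \<in> space S. \<forall>i\<in>A. (norm (channel \<eta> \<alpha> loc h i \<omega>))\<^sup>2 \<le> x}) =
      {\<omega> \<in> space S. ordered_gain M (channel \<eta> \<alpha> loc h) n \<omega> \<le> x}"
    unfolding ordered_gain_le_iff_ex[OF assms(1)] by blast
  finally show "{\<omega> \<in> space S. ordered_gain M (channel \<eta> \<alpha> loc h) n \<omega> \<le> x} \<in> events" .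
qed

lemma random_variable_residual_gain: "random_variable borel (residual_gain h\<^sub>I)"
proof -
  note [measurable] = random_variable_residual
  have "random_variable borel (\<lambda>\<omega>. \<Sum>k\<in>UNIV. (cmod (h\<^sub>I k \<omega>))\<^sup>2)" by measurable
  then show ?thesis by (simp add: residual_gain_def[abs_def] norm_vec_sq)
qed

section \<open>Distribution of the ordered gain near zero\<close>

text \<open>A union bound over the sets of \<open>n\<close> users, of which there are at most
  \<open>2 ^ M\<close>; for each set, \<open>n * CARD('k)\<close> independent coefficients must be
  small.\<close>

lemma prob_ordered_gain_le:
  fixes \<eta> \<alpha> x :: real
  assumes n: "n \<in> {1..M}" and pos: "\<eta> > 0" "\<alpha> > 0" "x \<ge> 0"
  shows "\<P>(\<omega> in S. ordered_gain M (channel \<eta> \<alpha> loc h) n \<omega> \<le> x)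
    \<le> 2 ^ M * (x * (1 + R\<^sub>D powr \<alpha>) / \<eta>) ^ (n * CARD('k))"
proof -
  \<comment> \<open>The bound on each squared fading modulus that a gain of at most \<open>x\<close>
    implies under the largest path loss, that at the edge of the disc.\<close>
  define s where "s = x * (1 + R\<^sub>D powr \<alpha>) / \<eta>"
  have "s \<ge> 0" using pos by (simp add: s_def)
  define \<A> where "\<A> = {A. A \<subseteq> {1..M} \<and> card A = n}"
  define F where "F A = {\<omega> \<in> space S. \<forall>i\<in>A. \<forall>k. h i k \<omega> \<in> cball 0 (sqrt s)}" for A
  have \<A>: "\<A> \<subseteq> Pow {1..M}" "finite \<A>"
    by (auto simp: \<A>_def)
  have "card \<A> \<le> 2 ^ M"
    using card_mono[OF _ \<A>(1)] by (simp add: card_Pow)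
  have F: "F A \<in> events" if "A \<in> \<A>" for A
  proof -
    have "{\<omega> \<in> space S. \<forall>k. h i k \<omega> \<in> cball 0 (sqrt s)} \<in> events" if "i \<in> {1..M}" for i
    proof -
      note [measurable] = random_variable_fading[OF that]
      show ?thesis unfolding mem_cball_0 by measurable
    qed
    then show ?thesis
      unfolding F_def using that finite_subset[of A "{1..M}"]
      by (intro sets.sets_Collect_finite_All) (auto simp: \<A>_def)
  qed
  have le: "(cmod (h i k \<omega>))\<^sup>2 \<le> s"
    if "(norm (channel \<eta> \<alpha> loc h i \<omega>))\<^sup>2 \<le> x" "cmod (loc i \<omega>) \<le> R\<^sub>D" for i k \<omega>
  proof -
    have "0 < 1 + cmod (loc i \<omega>) powr \<alpha>" by (intro add_pos_nonneg) auto
    moreover have "cmod (loc i \<omega>) powr \<alpha> \<le> R\<^sub>D powr \<alpha>"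
      using that pos by (intro powr_mono2) auto
    moreover have "(cmod (h i k \<omega>))\<^sup>2 \<le> (\<Sum>k\<in>UNIV. (cmod (h i k \<omega>))\<^sup>2)"
      by (rule member_le_sum) auto
    moreover have "\<eta> * (\<Sum>k\<in>UNIV. (cmod (h i k \<omega>))\<^sup>2) \<le> x * (1 + cmod (loc i \<omega>) powr \<alpha>)"
      using that(1) calculation(1) by (simp add: norm_channel_sq[OF pos(1)] pos_divide_le_eq)
    ultimately have "\<eta> * (cmod (h i k \<omega>))\<^sup>2 \<le> x * (1 + R\<^sub>D powr \<alpha>)"
      using pos by (smt (verit) mult_left_mono)
    then show ?thesis using pos by (simp add: s_def pos_le_divide_eq mult.commute)
  qed
  have "\<P>(\<omega> in S. ordered_gain M (channel \<eta> \<alpha> loc h) n \<omega> \<le> x) \<le> prob (\<Union>A\<in>\<A>. F A)"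
  proof (rule finite_measure_mono_AE)
    \<comment> \<open>The uniform law confines the users to the disc only almost surely, hence the
      inclusion of events up to a null set.\<close>
    have "AE \<omega> in S. \<forall>i\<in>{1..M}. cmod (loc i \<omega>) \<le> R\<^sub>D"
      using AE_location_le by (intro AE_finite_allI) auto
    then show "AE \<omega> in S. \<omega> \<in> {\<omega> \<in> space S. ordered_gain M (channel \<eta> \<alpha> loc h) n \<omega> \<le> x} \<longrightarrow>
        \<omega> \<in> (\<Union>A\<in>\<A>. F A)"
    proof eventually_elim
      case (elim \<omega>)
      show ?case
      proof
        assume "\<omega> \<in> {\<omega> \<in> space S. ordered_gain M (channel \<eta> \<alpha> loc h) n \<omega> \<le> x}"
        then obtain A where A: "\<omega> \<in> space S" "A \<in> \<A>"
            "\<And>i. i \<in> A \<Longrightarrow> (norm (channel \<eta> \<alpha> loc h i \<omega>))\<^sup>2 \<le> x"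
          unfolding ordered_gain_le_iff_ex[OF n] \<A>_def by blast
        then have "\<omega> \<in> F A"
          using le elim \<A>(1) by (fastforce simp: F_def intro: real_le_rsqrt)
        then show "\<omega> \<in> (\<Union>A\<in>\<A>. F A)" using A by blast
      qed
    qed
    show "(\<Union>A\<in>\<A>. F A) \<in> events" using F \<A> by blast
  qed
  also have "\<dots> \<le> (\<Sum>A\<in>\<A>. prob (F A))"
    using F \<A> by (intro finite_measure_subadditive_finite) auto
  also have "\<dots> \<le> (\<Sum>A\<in>\<A>. s ^ (n * CARD('k)))"
  proof (rule sum_mono)
    fix A assume "A \<in> \<A>"
    then have A: "A \<subseteq> {1..M}" "card A = n" by (auto simp: \<A>_def)
    have "prob (F A) = (\<Prod>i\<in>A. \<Prod>k\<in>UNIV. prob (h i k -` cball 0 (sqrt s) \<inter> space S))"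
      unfolding F_def using A by (intro prob_fading) auto
    also have "\<dots> \<le> (\<Prod>i\<in>A. \<Prod>k\<in>(UNIV :: 'k set). s)"
    proof (intro prod_mono conjI prod_nonneg ballI measure_nonneg)
      fix i k assume "i \<in> A"
      then show "prob (h i k -` cball 0 (sqrt s) \<inter> space S) \<le> s"
        using CN_prob_cball_le[OF fading_CN[of i k], of "sqrt s" 0] A \<open>s \<ge> 0\<close> by auto
    qed
    also have "\<dots> = s ^ (n * CARD('k))"
      by (simp add: A power_mult[symmetric] mult.commute)
    finally show "prob (F A) \<le> s ^ (n * CARD('k))" .
  qed
  also have "\<dots> = real (card \<A>) * s ^ (n * CARD('k))" by simp
  also have "\<dots> \<le> 2 ^ M * s ^ (n * CARD('k))"
  proof (rule mult_right_mono)
    show "real (card \<A>) \<le> 2 ^ M"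
      using of_nat_mono[OF \<open>card \<A> \<le> 2 ^ M\<close>, where 'a = real] by simp
  qed (use \<open>s \<ge> 0\<close> in simp)
  finally show ?thesis by (simp add: s_def)
qed

text \<open>The path loss denominator is at least 1, so distances can only reduce the gain. Each of
  the \<open>CARD('k)\<close> coefficients contributes at most an equal share of \<open>x\<close>,
  and the users \<open>1, ..., n\<close> witness the order statistic.\<close>

lemma ordered_gain_le_of_fading:
  fixes \<eta> \<alpha> x :: real
  assumes n: "n \<in> {1..M}" and pos: "\<eta> > 0" "x \<ge> 0"
    and small: "\<And>i k. i \<in> {1..n} \<Longrightarrow> h i k \<omega> \<in> cball 0 (sqrt (x / (\<eta> * CARD('k))))"
  shows "ordered_gain M (channel \<eta> \<alpha> loc h) n \<omega> \<le> x"
proof -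
  have "(norm (channel \<eta> \<alpha> loc h i \<omega>))\<^sup>2 \<le> x" if i: "i \<in> {1..n}" for i
  proof -
    have "(cmod (h i k \<omega>))\<^sup>2 \<le> x / (\<eta> * CARD('k))" for k
      using small[OF i, of k] pos by (simp add: sqrt_ge_absD)
    then have "(\<Sum>k\<in>UNIV. (cmod (h i k \<omega>))\<^sup>2) \<le> (\<Sum>k\<in>(UNIV :: 'k set). x / (\<eta> * CARD('k)))"
      by (intro sum_mono)
    then have "\<eta> * (\<Sum>k\<in>UNIV. (cmod (h i k \<omega>))\<^sup>2) \<le> x"
      using pos by (simp add: field_simps)
    also have "x \<le> x * (1 + cmod (loc i \<omega>) powr \<alpha>)"
      using pos by (simp add: algebra_simps)
    finally show ?thesis
      unfolding norm_channel_sq[OF pos(1)]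
      by (subst pos_divide_le_eq) (auto intro: add_pos_nonneg)
  qed
  then show ?thesis
    unfolding ordered_gain_le_iff_ex[OF n] using n by (intro exI[of _ "{1..n}"]) auto
qed

text \<open>One fixed set of \<open>n\<close> users suffices for a lower bound of the right order;
  the factor \<open>exp (- s)\<close> is the loss of Gaussian density at the rim of the disc of
  radius \<open>sqrt s\<close>.\<close>

lemma prob_ordered_gain_ge:
  fixes \<eta> \<alpha> x :: real
  assumes n: "n \<in> {1..M}" and pos: "\<eta> > 0" "x \<ge> 0"
  defines "s \<equiv> x / (\<eta> * CARD('k))"
  shows "(exp (- s) * s) ^ (n * CARD('k))
    \<le> \<P>(\<omega> in S. ordered_gain M (channel \<eta> \<alpha> loc h) n \<omega> \<le> x)"
proof -
  note [measurable] = random_variable_ordered_gain[OF n pos(1)]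
  have "s \<ge> 0" using pos by (simp add: s_def)
  have "(exp (- s) * s) ^ (n * CARD('k)) = (\<Prod>i\<in>{1..n}. \<Prod>k\<in>(UNIV :: 'k set). exp (- s) * s)"
    by (simp add: power_mult[symmetric] mult.commute)
  also have "\<dots> \<le> (\<Prod>i\<in>{1..n}. \<Prod>k\<in>UNIV. prob (h i k -` cball 0 (sqrt s) \<inter> space S))"
  proof (intro prod_mono conjI prod_nonneg ballI)
    fix i k assume "i \<in> {1..n}"
    then show "exp (- s) * s \<le> prob (h i k -` cball 0 (sqrt s) \<inter> space S)"
      using CN_prob_cball_ge[OF fading_CN[of i k], of "sqrt s" 0] n \<open>s \<ge> 0\<close> by auto
  qed (use \<open>s \<ge> 0\<close> in auto)
  also have "\<dots> = prob {\<omega> \<in> space S. \<forall>i\<in>{1..n}. \<forall>k. h i k \<omega> \<in> cball 0 (sqrt s)}"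
    using n by (intro prob_fading[symmetric]) auto
  also have "\<dots> \<le> \<P>(\<omega> in S. ordered_gain M (channel \<eta> \<alpha> loc h) n \<omega> \<le> x)"
  proof (rule finite_measure_mono)
    show "{\<omega> \<in> space S. \<forall>i\<in>{1..n}. \<forall>k. h i k \<omega> \<in> cball 0 (sqrt s)} \<subseteq>
        {\<omega> \<in> space S. ordered_gain M (channel \<eta> \<alpha> loc h) n \<omega> \<le> x}"
      using ordered_gain_le_of_fading[OF n pos] unfolding s_def by blast
  qed measurable
  finally show ?thesis .
qed

text \<open>Small fading for users \<open>1, ..., n\<close> forces a small gain, and residual
  entries in the unit disc about 2 have modulus at least 1. Each of these finitely many independent
  events has positive probability.\<close>

lemma prob_ordered_gain_le_residual_gain_ge_pos:
  fixes \<eta> \<alpha> x :: real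
  assumes n: "n \<in> {1..M}" and pos: "\<eta> > 0" "x > 0" "\<Omega>\<^sub>I > 0"
  shows "0 < \<P>(\<omega> in S. ordered_gain M (channel \<eta> \<alpha> loc h) n \<omega> \<le> x \<and> 1 \<le> residual_gain h\<^sub>I \<omega>)"
proof -
  note [measurable] = random_variable_ordered_gain[OF n pos(1)] random_variable_residual_gain
  define r where "r = sqrt (x / (\<eta> * CARD('k)))"
  have "r > 0" using pos by (simp add: r_def)
  have "0 < (\<Prod>i\<in>{1..n}. \<Prod>k\<in>UNIV. prob (h i k -` cball 0 r \<inter> space S)) *
      (\<Prod>k\<in>UNIV. prob (h\<^sub>I k -` cball 2 1 \<inter> space S))"
  proof (intro mult_pos_pos prod_pos ballI)
    fix i k assume "i \<in> {1..n}"
    then have "exp (- r\<^sup>2) * r\<^sup>2 \<le> prob (h i k -` cball 0 r \<inter> space S)"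
      using CN_prob_cball_ge[OF fading_CN[of i k], of r 0] n \<open>r > 0\<close> by auto
    moreover have "0 < exp (- r\<^sup>2) * r\<^sup>2" using \<open>r > 0\<close> by simp
    ultimately show "0 < prob (h i k -` cball 0 r \<inter> space S)" by linarith
  next
    fix k
    have "0 < exp (- (cmod 2 + 1)\<^sup>2 / \<Omega>\<^sub>I) * 1\<^sup>2 / \<Omega>\<^sub>I"
      using pos by simp
    also have "\<dots> \<le> prob (h\<^sub>I k -` cball 2 1 \<inter> space S)"
      by (rule CN_prob_cball_ge[OF residual_CN]) (use pos in auto)
    finally show "0 < prob (h\<^sub>I k -` cball 2 1 \<inter> space S)" .
  qed
  also have "\<dots> = prob {\<omega> \<in> space S. (\<forall>i\<in>{1..n}. \<forall>k. h i k \<omega> \<in> cball 0 r) \<and>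
      (\<forall>k. h\<^sub>I k \<omega> \<in> cball 2 1)}"
    using n by (intro prob_fading_residual[symmetric]) auto
  also have "\<dots> \<le> \<P>(\<omega> in S. ordered_gain M (channel \<eta> \<alpha> loc h) n \<omega> \<le> x \<and>
      1 \<le> residual_gain h\<^sub>I \<omega>)"
  proof (rule finite_measure_mono)
    show "{\<omega> \<in> space S. (\<forall>i\<in>{1..n}. \<forall>k. h i k \<omega> \<in> cball 0 r) \<and> (\<forall>k. h\<^sub>I k \<omega> \<in> cball 2 1)} \<subseteq>
        {\<omega> \<in> space S. ordered_gain M (channel \<eta> \<alpha> loc h) n \<omega> \<le> x \<and> 1 \<le> residual_gain h\<^sub>I \<omega>}"
    proof safe
      fix \<omega> assume fading: "\<forall>i\<in>{1..n}. \<forall>k. h i k \<omega> \<in> cball 0 r"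
        and residual: "\<forall>k. h\<^sub>I k \<omega> \<in> cball 2 1"
      show "ordered_gain M (channel \<eta> \<alpha> loc h) n \<omega> \<le> x"
        using fading pos unfolding r_def by (intro ordered_gain_le_of_fading[OF n]) auto
      have "1 \<le> cmod (h\<^sub>I k \<omega>)" for k
        using norm_triangle_sub[of 2 "h\<^sub>I k \<omega>"] spec[OF residual, of k] by (simp add: dist_norm)
      then have "(\<Sum>k\<in>(UNIV :: 'k set). 1) \<le> (\<Sum>k\<in>UNIV. (cmod (h\<^sub>I k \<omega>))\<^sup>2)"
        by (intro sum_mono) simp
      moreover have "1 \<le> real CARD('k)" by (simp add: Suc_le_eq)
      ultimately have "1 \<le> (\<Sum>k\<in>UNIV. (cmod (h\<^sub>I k \<omega>))\<^sup>2)"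
        unfolding sum_constant by linarith
      then show "1 \<le> residual_gain h\<^sub>I \<omega>"
        by (simp add: residual_gain_def norm_vec_sq)
    qed
  qed measurable
  finally show ?thesis .
qed

end

section \<open>Outage with imperfect and with perfect SIC\<close>

theorem mainTheorem7:
  fixes S :: "'a measure"
    and M m n :: nat
    and \<eta> \<alpha> R\<^sub>D \<Omega>\<^sub>I a\<^sub>m a\<^sub>n R\<^sub>m R\<^sub>n :: real
    and loc :: "nat \<Rightarrow> 'a \<Rightarrow> complex"
    and h :: "nat \<Rightarrow> 'k::finite \<Rightarrow> 'a \<Rightarrow> complex"
    and h\<^sub>I :: "'k \<Rightarrow> 'a \<Rightarrow> complex"
  assumes "CARD('k) < M"
    and "1 \<le> m" and "m < n" and "n \<le> M"
    and "\<eta> > 0" and "\<alpha> > 0" and "R\<^sub>D > 0" and "\<Omega>\<^sub>I > 0"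
    and "a\<^sub>m > a\<^sub>n" and "a\<^sub>n > 0" and "a\<^sub>m + a\<^sub>n = 1"
    and "R\<^sub>m > 0" and "R\<^sub>n > 0"
    and "noma_model S M R\<^sub>D \<Omega>\<^sub>I loc h h\<^sub>I"
    and "a\<^sub>m > target_sinr R\<^sub>m * a\<^sub>n"
    and "a\<^sub>n > target_sinr R\<^sub>n * a\<^sub>m"
  shows "has_diversity_order
           (outage_ALF S (ordered_gain M (channel \<eta> \<alpha> loc h) n) (residual_gain h\<^sub>I)
              a\<^sub>m a\<^sub>n R\<^sub>m R\<^sub>n 1) 0 \<and>
         has_diversity_order
           (outage_ALF S (ordered_gain M (channel \<eta> \<alpha> loc h) n) (residual_gain h\<^sub>I)
              a\<^sub>m a\<^sub>n R\<^sub>m R\<^sub>n 0) (real (n * CARD('k)))"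
proof -
  interpret noma_model S M R\<^sub>D \<Omega>\<^sub>I loc h h\<^sub>I by fact
  have n: "n \<in> {1..M}" using assms by simp
  define Z where "Z = ordered_gain M (channel \<eta> \<alpha> loc h) n"
  define Y where "Y = residual_gain h\<^sub>I"
  have [measurable]: "random_variable borel Z"
    unfolding Z_def by (rule random_variable_ordered_gain) fact+
  have [measurable]: "random_variable borel Y"
    unfolding Y_def by (rule random_variable_residual_gain)
  have Z_nonneg: "0 \<le> Z \<omega>" for \<omega>
    by (simp add: Z_def ordered_gain_def)
  define N where "N = n * CARD('k)"
  have "N > 0" using n by (simp add: N_def)
  define \<epsilon>\<^sub>m where "\<epsilon>\<^sub>m = target_sinr R\<^sub>m"
  define \<epsilon>\<^sub>n where "\<epsilon>\<^sub>n = target_sinr R\<^sub>n"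
  have \<epsilon>: "\<epsilon>\<^sub>m > 0" "\<epsilon>\<^sub>n > 0"
    using assms by (simp_all add: \<epsilon>\<^sub>m_def \<epsilon>\<^sub>n_def target_sinr_def)
  \<comment> \<open>The values of \<open>\<rho> * Z\<close> at which the SINRs reach their targets.
    The two assumptions on power coefficients and target rates make the denominators of
    \<open>\<tau>\<^sub>m\<close> and \<open>\<tau>\<^sub>n\<close> positive.\<close>
  define \<tau>\<^sub>m where "\<tau>\<^sub>m = \<epsilon>\<^sub>m / (a\<^sub>m - \<epsilon>\<^sub>m * a\<^sub>n)"
  define \<tau>\<^sub>n where "\<tau>\<^sub>n = \<epsilon>\<^sub>n / (a\<^sub>n - \<epsilon>\<^sub>n * a\<^sub>m)"
  define \<theta> where "\<theta> = \<epsilon>\<^sub>n / a\<^sub>n"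
  have thresholds: "\<tau>\<^sub>m > 0" "\<tau>\<^sub>n > 0" "\<theta> > 0"
    using assms \<epsilon> by (simp_all add: \<tau>\<^sub>m_def \<tau>\<^sub>n_def \<theta>_def \<epsilon>\<^sub>m_def[symmetric] \<epsilon>\<^sub>n_def[symmetric])
  have \<gamma>\<^sub>m: "\<gamma>_n_to_m a\<^sub>m a\<^sub>n \<rho> (Z \<omega>) \<le> \<epsilon>\<^sub>m \<longleftrightarrow> Z \<omega> \<le> \<tau>\<^sub>m / \<rho>" if "\<rho> > 0" for \<rho> \<omega>
    unfolding \<gamma>_n_to_m_def \<tau>\<^sub>m_def
    by (rule sinr_le_iff) (use that assms Z_nonneg in \<open>auto simp: \<epsilon>\<^sub>m_def\<close>)
  have \<gamma>\<^sub>n: "\<gamma>_n_to_n a\<^sub>m a\<^sub>n \<rho> (Z \<omega>) \<le> \<epsilon>\<^sub>n \<longleftrightarrow> Z \<omega> \<le> \<tau>\<^sub>n / \<rho>" if "\<rho> > 0" for \<rho> \<omega>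
    unfolding \<gamma>_n_to_n_def \<tau>\<^sub>n_def
    by (rule sinr_le_iff) (use that assms Z_nonneg in \<open>auto simp: \<epsilon>\<^sub>n_def\<close>)
  have \<gamma>\<^sub>0: "\<gamma>_n a\<^sub>n 0 \<rho> (Z \<omega>) y \<le> \<epsilon>\<^sub>n \<longleftrightarrow> Z \<omega> \<le> \<theta> / \<rho>" if "\<rho> > 0" for \<rho> \<omega> y
    using sinr_le_iff[of \<epsilon>\<^sub>n 0 a\<^sub>n \<rho> "Z \<omega>"] that assms Z_nonneg
    by (simp add: \<gamma>_n_def \<theta>_def)
  \<comment> \<open>Interference grows with \<open>\<rho>\<close> like the signal, so this outage
    condition is uniform in the SNR: the origin of the error floor.\<close>
  have \<gamma>\<^sub>1: "\<gamma>_n a\<^sub>n 1 \<rho> (Z \<omega>) (Y \<omega>) \<le> \<epsilon>\<^sub>n" if "\<rho> > 0" "Z \<omega> \<le> \<theta>" "1 \<le> Y \<omega>" for \<rho> \<omega>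
  proof -
    have "Z \<omega> * a\<^sub>n \<le> \<epsilon>\<^sub>n" using that assms by (simp add: \<theta>_def pos_le_divide_eq)
    also have "\<epsilon>\<^sub>n \<le> \<epsilon>\<^sub>n * Y \<omega>" using that \<epsilon> by simp
    finally have "\<rho> * (Z \<omega> * a\<^sub>n) \<le> \<rho> * (\<epsilon>\<^sub>n * Y \<omega>)"
      using that by (intro mult_left_mono) auto
    also have "\<dots> \<le> \<epsilon>\<^sub>n * (\<rho> * Y \<omega> + 1)"
      using \<epsilon> by (simp add: algebra_simps)
    finally show ?thesis
      unfolding \<gamma>_n_def using that
      by (subst pos_divide_le_eq) (auto intro!: add_nonneg_pos simp: mult.assoc)
  qed
  define P where "P \<kappa> = outage_ALF S Z Y a\<^sub>m a\<^sub>n R\<^sub>m R\<^sub>n \<kappa>" for \<kappa>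
  define p where "p x = \<P>(\<omega> in S. Z \<omega> \<le> x)" for x
  define B where "B = 2 ^ M * ((1 + R\<^sub>D powr \<alpha>) / \<eta>) ^ N"
  have p_le: "p x \<le> B * x ^ N" if "x \<ge> 0" for x
    using prob_ordered_gain_le[OF n \<open>\<eta> > 0\<close> \<open>\<alpha> > 0\<close> that]
    by (simp add: p_def Z_def N_def B_def power_mult_distrib power_divide mult_ac)
  \<comment> \<open>The exponential factor of the lower bound is frozen at its smallest value for
    \<open>x\<close> in the unit interval, attained at \<open>x = 1\<close>.\<close>
  define b where "b = (exp (- (1 / (\<eta> * CARD('k)))) / (\<eta> * CARD('k))) ^ N"
  have "b > 0" using \<open>\<eta> > 0\<close> by (simp add: b_def)
  have p_ge: "b * x ^ N \<le> p x" if "0 \<le> x" "x \<le> 1" for x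
  proof -
    have "b * x ^ N = (exp (- (1 / (\<eta> * CARD('k)))) * (x / (\<eta> * CARD('k)))) ^ N"
      by (simp add: b_def power_mult_distrib power_divide)
    also have "\<dots> \<le> (exp (- (x / (\<eta> * CARD('k)))) * (x / (\<eta> * CARD('k)))) ^ N"
      using that \<open>\<eta> > 0\<close>
      by (intro power_mono mult_right_mono) (auto intro!: divide_right_mono)
    also have "\<dots> \<le> p x"
      using prob_ordered_gain_ge[OF n \<open>\<eta> > 0\<close> that(1)] by (simp add: p_def Z_def N_def)
    finally show ?thesis .
  qed
  have "has_diversity_order (P 1) 0"
  proof -
    define q where "q = \<P>(\<omega> in S. Z \<omega> \<le> \<theta> \<and> 1 \<le> Y \<omega>)"
    have "q > 0"
      unfolding q_def Z_def Y_def
      using n \<open>\<eta> > 0\<close> \<open>\<theta> > 0\<close> \<open>\<Omega>\<^sub>I > 0\<close> by (rule prob_ordered_gain_le_residual_gain_ge_pos)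
    \<comment> \<open>The limit is 0 because \<open>N\<close> is positive.\<close>
    have "((\<lambda>\<rho>. B * (\<tau>\<^sub>m / \<rho>) ^ N) \<longlongrightarrow> B * 0 ^ N) at_top"
      by (intro tendsto_intros tendsto_divide_0[OF tendsto_const]
          filterlim_at_top_imp_at_infinity filterlim_ident)
    then have "eventually (\<lambda>\<rho>. B * (\<tau>\<^sub>m / \<rho>) ^ N < q / 2) at_top"
      using \<open>q > 0\<close> \<open>N > 0\<close> by (intro order_tendstoD) (auto simp: zero_power)
    then have "eventually (\<lambda>\<rho>. q / 2 * \<rho> powr (- 0) \<le> P 1 \<rho>) at_top"
      using eventually_gt_at_top[of 0]
    proof eventually_elim
      case (elim \<rho>)
      \<comment> \<open>Either the signal of user \<open>m\<close> is not decoded, which requires a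
        gain of order \<open>1 / \<rho>\<close>, or it is decoded and the residual interference
        causes the outage.\<close>
      have "q \<le> prob ({\<omega> \<in> space S. Z \<omega> \<le> \<tau>\<^sub>m / \<rho>} \<union>
          {\<omega> \<in> space S. \<gamma>_n_to_m a\<^sub>m a\<^sub>n \<rho> (Z \<omega>) > \<epsilon>\<^sub>m \<and> \<gamma>_n a\<^sub>n 1 \<rho> (Z \<omega>) (Y \<omega>) \<le> \<epsilon>\<^sub>n})"
        unfolding q_def
      proof (rule finite_measure_mono)
        show "{\<omega> \<in> space S. Z \<omega> \<le> \<theta> \<and> 1 \<le> Y \<omega>} \<subseteq> {\<omega> \<in> space S. Z \<omega> \<le> \<tau>\<^sub>m / \<rho>} \<union>
          {\<omega> \<in> space S. \<gamma>_n_to_m a\<^sub>m a\<^sub>n \<rho> (Z \<omega>) > \<epsilon>\<^sub>m \<and> \<gamma>_n a\<^sub>n 1 \<rho> (Z \<omega>) (Y \<omega>) \<le> \<epsilon>\<^sub>n}"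
          using \<gamma>\<^sub>m \<gamma>\<^sub>1 elim by (auto simp: not_le[symmetric])
      qed (unfold \<gamma>_n_to_m_def \<gamma>_n_def, measurable)
      also have "\<dots> \<le> p (\<tau>\<^sub>m / \<rho>) +
          \<P>(\<omega> in S. \<gamma>_n_to_m a\<^sub>m a\<^sub>n \<rho> (Z \<omega>) > \<epsilon>\<^sub>m \<and> \<gamma>_n a\<^sub>n 1 \<rho> (Z \<omega>) (Y \<omega>) \<le> \<epsilon>\<^sub>n)"
        unfolding p_def \<gamma>_n_to_m_def \<gamma>_n_def by (rule measure_Un_le) measurable
      also have "\<dots> \<le> p (\<tau>\<^sub>m / \<rho>) + P 1 \<rho>"
        by (simp add: P_def outage_ALF_def \<epsilon>\<^sub>m_def \<epsilon>\<^sub>n_def)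
      finally have "q \<le> p (\<tau>\<^sub>m / \<rho>) + P 1 \<rho>" .
      moreover have "p (\<tau>\<^sub>m / \<rho>) \<le> B * (\<tau>\<^sub>m / \<rho>) ^ N"
        using thresholds elim by (intro p_le) simp
      ultimately have "q / 2 \<le> P 1 \<rho>" using elim by linarith
      then show ?case using elim by simp
    qed
    \<comment> \<open>The constant is 2 since the outage is written as a sum of two probabilities,
      each bounded by 1.\<close>
    moreover have "eventually (\<lambda>\<rho>. P 1 \<rho> \<le> 2 * \<rho> powr (- 0)) at_top"
      using eventually_gt_at_top[of 0]
    proof eventually_elim
      case (elim \<rho>)
      have "P 1 \<rho> \<le> 1 + 1"
        unfolding P_def outage_ALF_def by (intro add_mono prob_le_1)
      then show ?case using elim by simp
    qed
    ultimately show ?thesis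
      using \<open>q > 0\<close> by (intro has_diversity_orderI[of "q / 2"]) auto
  qed
  moreover have "has_diversity_order (P 0) (real N)"
  proof (rule has_diversity_orderI)
    \<comment> \<open>The first outage term imposes both thresholds. It alone gives the lower bound,
      as the second event is empty when \<open>\<theta>\<close> is at most
      \<open>\<tau>\<^sub>m\<close>.\<close>
    define \<tau> where "\<tau> = min \<tau>\<^sub>m \<tau>\<^sub>n"
    have "\<tau> > 0" using thresholds by (simp add: \<tau>_def)
    show "0 < b * \<tau> ^ N" using \<open>b > 0\<close> \<open>\<tau> > 0\<close> by simp
    have P0: "P 0 \<rho> = p (\<tau> / \<rho>) + \<P>(\<omega> in S. Z \<omega> > \<tau>\<^sub>m / \<rho> \<and> Z \<omega> \<le> \<theta> / \<rho>)" if "\<rho> > 0" for \<rho>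
    proof -
      have "Z \<omega> \<le> \<tau>\<^sub>m / \<rho> \<and> Z \<omega> \<le> \<tau>\<^sub>n / \<rho> \<longleftrightarrow> Z \<omega> \<le> \<tau> / \<rho>" for \<omega>
        using that by (simp add: \<tau>_def pos_le_divide_eq)
      then show ?thesis
        using that \<gamma>\<^sub>m[OF that] \<gamma>\<^sub>n[OF that] \<gamma>\<^sub>0[OF that]
        by (simp add: P_def outage_ALF_def \<epsilon>\<^sub>m_def[symmetric] \<epsilon>\<^sub>n_def[symmetric] p_def not_le[symmetric])
    qed
    have powr: "(t / \<rho>) ^ N = t ^ N * \<rho> powr (- real N)" if "\<rho> > 0" for t \<rho> :: real
      using that by (simp add: power_divide powr_minus powr_realpow field_simps)
    show "eventually (\<lambda>\<rho>. b * \<tau> ^ N * \<rho> powr (- real N) \<le> P 0 \<rho>) at_top"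
      \<comment> \<open>From \<open>\<rho> = \<tau>\<close> on, \<open>\<tau> / \<rho>\<close> lies
        in the unit interval, as \<open>p_ge\<close> requires.\<close>
      using eventually_gt_at_top[of 0] eventually_ge_at_top[of \<tau>]
    proof eventually_elim
      case (elim \<rho>)
      have "b * (\<tau> / \<rho>) ^ N \<le> p (\<tau> / \<rho>)"
        using elim \<open>\<tau> > 0\<close> by (intro p_ge) auto
      also have "\<dots> \<le> P 0 \<rho>" using P0 elim by simp
      finally show ?case using powr elim by simp
    qed
    show "eventually (\<lambda>\<rho>. P 0 \<rho> \<le> B * (\<tau> ^ N + \<theta> ^ N) * \<rho> powr (- real N)) at_top"
      using eventually_gt_at_top[of 0]
    proof eventually_elim
      case (elim \<rho>)
      have "\<P>(\<omega> in S. Z \<omega> > \<tau>\<^sub>m / \<rho> \<and> Z \<omega> \<le> \<theta> / \<rho>) \<le> p (\<theta> / \<rho>)"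
        unfolding p_def by (rule finite_measure_mono) auto
      then have "P 0 \<rho> \<le> p (\<tau> / \<rho>) + p (\<theta> / \<rho>)" using P0 elim by simp
      also have "\<dots> \<le> B * (\<tau> / \<rho>) ^ N + B * (\<theta> / \<rho>) ^ N"
        using elim thresholds \<open>\<tau> > 0\<close> by (intro add_mono p_le) auto
      finally show ?case using powr elim by (simp add: algebra_simps)
    qed
  qed
  ultimately show ?thesis
    by (simp add: P_def[abs_def] Z_def Y_def N_def)
qed

end
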